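(* Let $X$ be a strongly $0$-dimensional metrizable space. Then the set $\mathrm{DC}(X)$ is a dense $G_{\delta}$ subset of the space $(\mathrm{Met}(X), \mathcal{D}_{X})$.
   Context: A topological space $X$ is strongly $0$-dimensional if for every pair $A, B$ of disjoint closed subsets of $X$ there exists a clopen set $V$ with $A\subset V$ and $V\cap B=\emptyset$. For a metrizable space $X$ and a subset $S\subset[0,\infty)$ with $0\in S$, $\mathrm{Met}(X;S)$ denotes the set of all metrics on $X$ that generate the given topology of $X$ and take values in $S$; $\mathrm{Met}(X)=\mathrm{Met}(X;[0,\infty))$. The function $\mathcal{D}_{X}(d,e)=\sup_{x,y\in X}|d(x,y)-e(x,y)|\in[0,\infty]$ is a $[0,\infty]$-valued metric on $\mathrm{Met}(X)$, and $\mathrm{Met}(X)$ carries the topology generated by its open balls. A topological space is totally disconnected if each of its connected components is a singleton. $\mathcal{Z}$ denotes the set of all closed totally disconnected subsets of $[0,\infty)$ containing $0$, and $\mathrm{DC}(X)=\bigcup_{S\in\mathcal{Z}}\mathrm{Met}(X;S)$. *)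

theory Defs
  imports "HOL-Analysis.Analysis"
begin

definition strongly_zero_dimensional :: "'a topology \<Rightarrow> bool" where
  "strongly_zero_dimensional X \<longleftrightarrow>
     (\<forall>A B. closedin X A \<and> closedin X B \<and> A \<inter> B = {} \<longrightarrow>
        (\<exists>V. openin X V \<and> closedin X V \<and> A \<subseteq> V \<and> V \<inter> B = {}))"

definition totally_disconnected :: "'a topology \<Rightarrow> bool" where
  "totally_disconnected X \<longleftrightarrow> (\<forall>C \<in> connected_components_of X. is_singleton C)"

text \<open>A metric on \<open>topspace X\<close> is represented by a function on the whole type that vanishes when an
  argument lies outside \<open>topspace X\<close>. This makes the representation unique: two
  such functions are equal exactly if they agree on \<open>topspace X\<close>. The value \<open>0\<close> is chosen because
  \<^locale>\<open>Metric_space\<close> demands nonnegativity and symmetry on the whole type.\<close>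

definition Met_in :: "'a topology \<Rightarrow> real set \<Rightarrow> ('a \<Rightarrow> 'a \<Rightarrow> real) set" where
  "Met_in X S =
     {d. Metric_space (topspace X) d \<and>
         Metric_space.mtopology (topspace X) d = X \<and>
         (\<forall>x\<in>topspace X. \<forall>y\<in>topspace X. d x y \<in> S) \<and>
         (\<forall>x y. x \<notin> topspace X \<or> y \<notin> topspace X \<longrightarrow> d x y = 0)}"

abbreviation Met :: "'a topology \<Rightarrow> ('a \<Rightarrow> 'a \<Rightarrow> real) set" where
  "Met X \<equiv> Met_in X {0..}"

definition Met_dist :: "'a topology \<Rightarrow> ('a \<Rightarrow> 'a \<Rightarrow> real) \<Rightarrow> ('a \<Rightarrow> 'a \<Rightarrow> real) \<Rightarrow> ennreal" where
  "Met_dist X d e =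
     (SUP (x, y) \<in> topspace X \<times> topspace X. ennreal \<bar>d x y - e x y\<bar>)"

definition Met_topology :: "'a topology \<Rightarrow> ('a \<Rightarrow> 'a \<Rightarrow> real) topology" where
  "Met_topology X =
     topology_generated_by {{e \<in> Met X. Met_dist X d e < ennreal r} | d r. d \<in> Met X \<and> 0 < r}"

definition closed_totally_disconnected_sets :: "real set set" where
  "closed_totally_disconnected_sets =
     {S. S \<subseteq> {0..} \<and> 0 \<in> S \<and> closed S \<and> totally_disconnected (top_of_set S)}"

definition DC :: "'a topology \<Rightarrow> ('a \<Rightarrow> 'a \<Rightarrow> real) set" where
  "DC X = (\<Union>S \<in> closed_totally_disconnected_sets. Met_in X S)"

lemma Met_dist_eq_0_iff:
  assumes "d \<in> Met X" "e \<in> Met X"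
  shows "Met_dist X d e = 0 \<longleftrightarrow> d = e"
proof
  assume "Met_dist X d e = 0"
  then have agree: "d x y = e x y" if "x \<in> topspace X" "y \<in> topspace X" for x y
    using that by (simp add: Met_dist_def SUP_eq_iff flip: bot_ennreal)
      (simp add: bot_ennreal ennreal_eq_0_iff split: prod.splits)
  show "d = e"
  proof (intro ext)
    fix x y
    show "d x y = e x y"
      using agree assms unfolding Met_in_def by (cases "x \<in> topspace X \<and> y \<in> topspace X") auto
  qed
next
  assume "d = e"
  then have "Met_dist X d e \<le> 0"
    unfolding Met_dist_def by (intro SUP_least) auto
  then show "Met_dist X d e = 0"
    by simp
qed

lemma topspace_Met_topology: "topspace (Met_topology X) = Met X"
proof -
  have "\<exists>U. (\<exists>d r. U = {e \<in> Met X. Met_dist X d e < ennreal r} \<and> d \<in> Met X \<and> 0 < r) \<and> d \<in> U"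
    if "d \<in> Met X" for d
  proof -
    have "d \<in> {e \<in> Met X. Met_dist X d e < ennreal 1}"
      using that Met_dist_eq_0_iff[OF that that] by simp
    then show ?thesis
      using that zero_less_one by blast
  qed
  then have "\<Union> {{e \<in> Met X. Met_dist X d e < ennreal r} | d r. d \<in> Met X \<and> 0 < r} = Met X"
    by blast
  then show ?thesis
    by (simp only: Met_topology_def topology_generated_by_topspace)
qed

end

theory Submission
  imports Defs "HOL-Real_Asymp.Real_Asymp"
begin

text \<open>A metric lies in \<open>DC X\<close> iff its values omit an open subinterval of every interval with rational
  end points; shrinking the omitted interval shows that each of these conditions is open. For
  density, zero-dimensionality yields partitions of \<open>X\<close> into open sets of small diameter. A given
  metric is rounded to a multiple of \<open>\<epsilon>\<close> between the pieces of such a partition, and inside the pieces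
  it is replaced by an ultrametric obtained from finer and finer partitions.\<close>

section \<open>The topology of uniform convergence\<close>

text \<open>This removes \<open>ennreal\<close> from everything that follows. The uniform bound
  \<open>s\<close> has to stay strictly below \<open>r\<close>, since pointwise bounds by values
  smaller than \<open>r\<close> only give a supremum of at most \<open>r\<close>.\<close>

lemma Met_dist_less_iff:
  assumes "0 < r"
  shows "Met_dist X d e < ennreal r \<longleftrightarrow>
    (\<exists>s. 0 \<le> s \<and> s < r \<and> (\<forall>x\<in>topspace X. \<forall>y\<in>topspace X. \<bar>d x y - e x y\<bar> \<le> s))"
proof
  assume less: "Met_dist X d e < ennreal r"
  define s where "s = enn2real (Met_dist X d e)"
  have s: "Met_dist X d e = ennreal s" "0 \<le> s"
    using less by (auto simp: s_def ennreal_enn2real_if)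
  have "\<bar>d x y - e x y\<bar> \<le> s" if "x \<in> topspace X" "y \<in> topspace X" for x y
  proof -
    have "ennreal \<bar>d x y - e x y\<bar> \<le> Met_dist X d e"
      unfolding Met_dist_def using that by (intro SUP_upper2[of "(x, y)"]) auto
    then show ?thesis
      using s by simp
  qed
  moreover have "s < r"
    using less s by (simp add: ennreal_less_iff)
  ultimately show "\<exists>s. 0 \<le> s \<and> s < r \<and> (\<forall>x\<in>topspace X. \<forall>y\<in>topspace X. \<bar>d x y - e x y\<bar> \<le> s)"
    using s by blast
next
  assume "\<exists>s. 0 \<le> s \<and> s < r \<and> (\<forall>x\<in>topspace X. \<forall>y\<in>topspace X. \<bar>d x y - e x y\<bar> \<le> s)"
  then obtain s where s: "0 \<le> s" "s < r"
    "\<And>x y. x \<in> topspace X \<Longrightarrow> y \<in> topspace X \<Longrightarrow> \<bar>d x y - e x y\<bar> \<le> s"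
    by blast
  have "Met_dist X d e \<le> ennreal s"
    unfolding Met_dist_def using s by (intro SUP_least) (auto intro: ennreal_leI)
  also have "\<dots> < ennreal r"
    using s by (simp add: ennreal_less_iff)
  finally show "Met_dist X d e < ennreal r" .
qed

text \<open>The balls enter the topology only as a subbase, so the neighbourhood property is carried
  through the generation of \<open>U\<close> by induction, with \<open>d \<in> U\<close> as a
  premise inside the claim.\<close>

lemma openin_Met_topology_imp:
  assumes "openin (Met_topology X) U" and "d \<in> U"
  shows "\<exists>r>0. \<forall>e\<in>Met X. (\<forall>x\<in>topspace X. \<forall>y\<in>topspace X. \<bar>d x y - e x y\<bar> \<le> r) \<longrightarrow> e \<in> U"
proof -
  let ?near = "\<lambda>r e. \<forall>x\<in>topspace X. \<forall>y\<in>topspace X. \<bar>d x y - e x y\<bar> \<le> r"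
  let ?B = "{{e \<in> Met X. Met_dist X d e < ennreal r} | d r. d \<in> Met X \<and> 0 < r}"
  have "generate_topology_on ?B U"
    using assms(1) by (simp add: Met_topology_def openin_topology_generated_by_iff)
  then have "d \<in> U \<longrightarrow> (\<exists>r>0. \<forall>e\<in>Met X. ?near r e \<longrightarrow> e \<in> U)"
  proof induction
    case Empty
    then show ?case by simp
  next
    case (Int a b)
    show ?case
    proof
      assume "d \<in> a \<inter> b"
      then obtain r s where r: "r > 0" "\<And>e. e \<in> Met X \<Longrightarrow> ?near r e \<Longrightarrow> e \<in> a"
        and s: "s > 0" "\<And>e. e \<in> Met X \<Longrightarrow> ?near s e \<Longrightarrow> e \<in> b"
        using Int by blast
      have "\<forall>e\<in>Met X. ?near (min r s) e \<longrightarrow> e \<in> a \<inter> b"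
        using r(2) s(2) by simp
      then show "\<exists>r>0. \<forall>e\<in>Met X. ?near r e \<longrightarrow> e \<in> a \<inter> b"
        using r(1) s(1) by (metis min_less_iff_conj)
    qed
  next
    case (UN K)
    show ?case
    proof
      assume "d \<in> \<Union>K"
      then obtain k where k: "k \<in> K" "d \<in> k" by blast
      then obtain r where "r > 0" "\<forall>e\<in>Met X. ?near r e \<longrightarrow> e \<in> k"
        using UN.IH by blast
      then show "\<exists>r>0. \<forall>e\<in>Met X. ?near r e \<longrightarrow> e \<in> \<Union>K"
        using k(1) by blast
    qed
  next
    case (Basis B)
    then obtain c r where B: "B = {e \<in> Met X. Met_dist X c e < ennreal r}" "0 < r"
      by blast
    show ?case
    proof
      assume "d \<in> B"
      then obtain s where s: "0 \<le> s" "s < r"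
        "\<And>x y. x \<in> topspace X \<Longrightarrow> y \<in> topspace X \<Longrightarrow> \<bar>c x y - d x y\<bar> \<le> s"
        using B Met_dist_less_iff[OF B(2), of X c d] by auto
      \<comment> \<open>Only half of the slack \<open>r - s\<close> is spent, so that the resulting
        bound \<open>(r + s) / 2\<close> is still strictly below \<open>r\<close>.\<close>
      have "e \<in> B" if e: "e \<in> Met X" "?near ((r - s) / 2) e" for e
      proof -
        have "\<bar>c x y - e x y\<bar> \<le> (r + s) / 2" if "x \<in> topspace X" "y \<in> topspace X" for x y
        proof -
          have "\<bar>c x y - d x y\<bar> \<le> s" "\<bar>d x y - e x y\<bar> \<le> (r - s) / 2"
            using s(3) e(2) that by auto
          then show ?thesis
            by argo
        qed
        moreover have "0 \<le> (r + s) / 2" "(r + s) / 2 < r"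
          using s by auto
        ultimately show ?thesis
          using B e(1) Met_dist_less_iff[OF B(2), of X c e] by blast
      qed
      then show "\<exists>r>0. \<forall>e\<in>Met X. ?near r e \<longrightarrow> e \<in> B"
        using s(2) by (intro exI[of _ "(r - s) / 2"]) auto
    qed
  qed
  then show ?thesis
    using assms(2) by blast
qed

lemma openin_Met_topologyI:
  assumes "U \<subseteq> Met X"
    and near: "\<And>d. d \<in> U \<Longrightarrow> \<exists>r>0. \<forall>e\<in>Met X.
      (\<forall>x\<in>topspace X. \<forall>y\<in>topspace X. \<bar>d x y - e x y\<bar> \<le> r) \<longrightarrow> e \<in> U"
  shows "openin (Met_topology X) U"
proof (subst openin_subopen, intro ballI)
  fix d assume d: "d \<in> U"
  then obtain r where r: "r > 0" "\<And>e. e \<in> Met X \<Longrightarrow>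
      (\<forall>x\<in>topspace X. \<forall>y\<in>topspace X. \<bar>d x y - e x y\<bar> \<le> r) \<Longrightarrow> e \<in> U"
    using near by blast
  define B where "B = {e \<in> Met X. Met_dist X d e < ennreal r}"
  have dM: "d \<in> Met X"
    using d assms(1) by blast
  have "openin (Met_topology X) B"
    unfolding Met_topology_def B_def using dM r(1) by (intro topology_generated_by_Basis) blast
  moreover have "d \<in> B"
    using dM r(1) Met_dist_eq_0_iff[OF dM dM] by (simp add: B_def)
  moreover have "B \<subseteq> U"
  proof
    fix e assume "e \<in> B"
    then have e: "e \<in> Met X" "Met_dist X d e < ennreal r"
      by (auto simp: B_def)
    then obtain s where "s < r" "\<forall>x\<in>topspace X. \<forall>y\<in>topspace X. \<bar>d x y - e x y\<bar> \<le> s"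
      using Met_dist_less_iff[OF r(1), of X d e] by blast
    then have "\<forall>x\<in>topspace X. \<forall>y\<in>topspace X. \<bar>d x y - e x y\<bar> \<le> r"
      by (meson less_imp_le order_trans)
    with e(1) show "e \<in> U"
      by (rule r(2))
  qed
  ultimately show "\<exists>T. openin (Met_topology X) T \<and> d \<in> T \<and> T \<subseteq> U"
    by blast
qed

section \<open>Metrics whose values omit an interval\<close>

text \<open>Connected subsets of the line are order-convex, so a component with two points contains
  the compact interval between them.\<close>

lemma totally_disconnected_real_iff:
  fixes S :: "real set"
  shows "totally_disconnected (top_of_set S) \<longleftrightarrow> (\<forall>p q. p < q \<longrightarrow> \<not> {p..q} \<subseteq> S)"
proof
  assume S: "totally_disconnected (top_of_set S)"
  show "\<forall>p q. p < q \<longrightarrow> \<not> {p..q} \<subseteq> S"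
  proof (intro allI impI notI)
    fix p q assume "p < q" "{p..q} \<subseteq> S"
    then have "connectedin (top_of_set S) {p..q}" "p \<in> topspace (top_of_set S)"
      by (auto simp: connectedin_subtopology)
    then have "{p..q} \<subseteq> connected_component_of_set (top_of_set S) p"
      using \<open>p < q\<close> by (intro connected_component_of_maximal) auto
    moreover have "is_singleton (connected_component_of_set (top_of_set S) p)"
      using S \<open>p \<in> topspace (top_of_set S)\<close>
      unfolding totally_disconnected_def connected_components_of_def by blast
    then obtain z where "connected_component_of_set (top_of_set S) p = {z}"
      by (auto simp: is_singleton_def)
    ultimately have "{p..q} \<subseteq> {z}"
      by simp
    moreover have "p \<in> {p..q}" "q \<in> {p..q}"
      using \<open>p < q\<close> by auto
    ultimately have "p = z" "q = z"
      by blast+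
    with \<open>p < q\<close> show False
      by simp
  qed
next
  assume S: "\<forall>p q. p < q \<longrightarrow> \<not> {p..q} \<subseteq> S"
  show "totally_disconnected (top_of_set S)"
    unfolding totally_disconnected_def
  proof
    fix C assume C: "C \<in> connected_components_of (top_of_set S)"
    then have "connected C" "C \<subseteq> S"
      using connectedin_connected_components_of[OF C] by (auto simp: connectedin_subtopology)
    moreover have "C \<noteq> {}"
      using C nonempty_connected_components_of by blast
    moreover have "x = y" if "x \<in> C" "y \<in> C" for x y
    proof -
      have "{min x y..max x y} \<subseteq> C"
        using that \<open>connected C\<close> by (intro connected_contains_Icc) (auto simp: min_def max_def)
      then show ?thesis
        using S \<open>C \<subseteq> S\<close> by (metis order_trans min_less_iff_conj max_less_iff_conj linorder_cases
            less_max_iff_disj min_less_iff_disj)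
    qed
    ultimately show "is_singleton C"
      by (metis is_singletonI')
  qed
qed

text \<open>The position of the gap is quantified existentially because omitting one fixed interval
  need not be an open condition, whereas a movable gap can shrink under perturbation.\<close>

definition gap_metrics :: "'a topology \<Rightarrow> real \<Rightarrow> real \<Rightarrow> ('a \<Rightarrow> 'a \<Rightarrow> real) set" where
  "gap_metrics X p q = {d \<in> Met X. \<exists>a b. p < a \<and> a < b \<and> b < q \<and>
     (\<forall>x\<in>topspace X. \<forall>y\<in>topspace X. d x y \<notin> {a<..<b})}"

lemma openin_gap_metrics: "openin (Met_topology X) (gap_metrics X p q)"
proof (rule openin_Met_topologyI)
  fix d assume "d \<in> gap_metrics X p q"
  then obtain a b where ab: "p < a" "a < b" "b < q"
    and gap: "\<And>x y. x \<in> topspace X \<Longrightarrow> y \<in> topspace X \<Longrightarrow> d x y \<notin> {a<..<b}"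
    by (auto simp: gap_metrics_def)
  \<comment> \<open>An \<open>r\<close>-close metric has values shifted by at most \<open>r\<close>;
    cutting a third off each end leaves a gap of length \<open>r\<close>.\<close>
  define r where "r = (b - a) / 3"
  have r: "r > 0" "a + r < b - r"
    using ab by (auto simp: r_def field_simps)
  have "e \<in> gap_metrics X p q" if "e \<in> Met X"
    and near: "\<forall>x\<in>topspace X. \<forall>y\<in>topspace X. \<bar>d x y - e x y\<bar> \<le> r" for e
  proof -
    have "e x y \<notin> {a + r<..<b - r}" if "x \<in> topspace X" "y \<in> topspace X" for x y
    proof -
      have "d x y \<notin> {a<..<b}" "\<bar>d x y - e x y\<bar> \<le> r"
        using gap near that by auto
      then show ?thesis
        by auto
    qed
    then show ?thesis
      using ab r \<open>e \<in> Met X\<close> unfolding gap_metrics_def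
      by (intro CollectI conjI exI[of _ "a + r"] exI[of _ "b - r"]) auto
  qed
  then show "\<exists>r>0. \<forall>e\<in>Met X. (\<forall>x\<in>topspace X. \<forall>y\<in>topspace X. \<bar>d x y - e x y\<bar> \<le> r) \<longrightarrow>
      e \<in> gap_metrics X p q"
    using r(1) by blast
qed (auto simp: gap_metrics_def)

text \<open>Total disconnectedness yields a single value missing from \<open>S\<close>, and
  closedness of \<open>S\<close> widens it to an interval.\<close>

lemma DC_subset_gap_metrics:
  assumes "p < q"
  shows "DC X \<subseteq> gap_metrics X p q"
proof
  fix d assume "d \<in> DC X"
  then obtain S where S: "S \<subseteq> {0..}" "closed S" "totally_disconnected (top_of_set S)"
    and d: "d \<in> Met_in X S"
    by (auto simp: DC_def closed_totally_disconnected_sets_def)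
  \<comment> \<open>Looking for the missing point in the middle third leaves a margin on both sides,
    so a small interval around it stays between \<open>p\<close> and \<open>q\<close>.\<close>
  define p' q' where "p' = (2 * p + q) / 3" and "q' = (p + 2 * q) / 3"
  have pq: "p < p'" "p' < q'" "q' < q"
    using assms by (auto simp: p'_def q'_def)
  obtain t where t: "t \<in> {p'..q'}" "t \<notin> S"
    using S(3) pq(2) unfolding totally_disconnected_real_iff by blast
  obtain r where r: "r > 0" "\<And>u. \<bar>u - t\<bar> < r \<Longrightarrow> u \<notin> S"
    using S(2) t(2) unfolding closed_def open_dist dist_real_def by blast
  define s where "s = min r (min (p' - p) (q - q')) / 2"
  have "0 < s" "s < r" "p < t - s" "t + s < q"
    using r(1) pq t(1) unfolding s_def by (auto simp: min_def field_simps)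
  have "d x y \<notin> {t - s<..<t + s}" if "x \<in> topspace X" "y \<in> topspace X" for x y
  proof
    assume "d x y \<in> {t - s<..<t + s}"
    then have "\<bar>d x y - t\<bar> < r"
      using \<open>s < r\<close> by auto
    then show False
      using r(2) d that by (auto simp: Met_in_def)
  qed
  moreover have "d \<in> Met X"
    using d S(1) by (auto simp: Met_in_def)
  ultimately show "d \<in> gap_metrics X p q"
    using \<open>0 < s\<close> \<open>p < t - s\<close> \<open>t + s < q\<close> unfolding gap_metrics_def
    by (intro CollectI conjI exI[of _ "t - s"] exI[of _ "t + s"]) auto
qed

lemma DC_eq_Inter_gap_metrics:
  "DC X = (\<Inter>(p, q) \<in> {(p, q) \<in> \<rat> \<times> \<rat>. p < q}. gap_metrics X p q)"
proof
  show "DC X \<subseteq> (\<Inter>(p, q) \<in> {(p, q) \<in> \<rat> \<times> \<rat>. p < q}. gap_metrics X p q)"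
    using DC_subset_gap_metrics by blast
next
  show "(\<Inter>(p, q) \<in> {(p, q) \<in> \<rat> \<times> \<rat>. p < q}. gap_metrics X p q) \<subseteq> DC X"
  proof
    fix d assume "d \<in> (\<Inter>(p, q) \<in> {(p, q) \<in> \<rat> \<times> \<rat>. p < q}. gap_metrics X p q)"
    then have gap: "d \<in> gap_metrics X p q" if "p \<in> \<rat>" "q \<in> \<rat>" "p < q" for p q
      using that by blast
    have d: "d \<in> Met X"
      using gap[of 0 1] by (simp add: gap_metrics_def)
    \<comment> \<open>The closure of the value set is the smallest candidate for \<open>S\<close>.
      The point 0 is inserted for the empty space, which has no values at all.\<close>
    define I where "I = insert 0 ((\<lambda>(x, y). d x y) ` (topspace X \<times> topspace X))"
    have "closure I \<subseteq> {0..}"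
      using d by (intro closure_minimal) (auto simp: I_def Met_in_def)
    moreover have "totally_disconnected (top_of_set (closure I))"
      unfolding totally_disconnected_real_iff
    proof (intro allI impI notI)
      fix u v :: real assume "u < v" "{u..v} \<subseteq> closure I"
      \<comment> \<open>This puts the gap found below strictly to the right of 0, so that it also
        avoids the inserted point.\<close>
      then have "0 \<le> u"
        using \<open>closure I \<subseteq> {0..}\<close> by fastforce
      obtain p where p: "p \<in> \<rat>" "u < p" "p < v"
        using Rats_dense_in_real[OF \<open>u < v\<close>] by blast
      obtain q where q: "q \<in> \<rat>" "p < q" "q < v"
        using Rats_dense_in_real[OF \<open>p < v\<close>] by blast
      obtain a b where ab: "p < a" "a < b" "b < q"
        "\<And>x y. x \<in> topspace X \<Longrightarrow> y \<in> topspace X \<Longrightarrow> d x y \<notin> {a<..<b}"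
        using gap[OF p(1) q(1,2)] unfolding gap_metrics_def by blast
      have "I \<inter> {a<..<b} = {}"
        using ab(1,4) \<open>0 \<le> u\<close> p(2) by (force simp: I_def)
      \<comment> \<open>The gap is open, so no limit point of \<open>I\<close> falls into
        it.\<close>
      then have "closure I \<inter> {a<..<b} = {}"
        using open_Int_closure_eq_empty[of "{a<..<b}" I] by (simp add: Int_commute)
      moreover have "(a + b) / 2 \<in> {u..v}" "(a + b) / 2 \<in> {a<..<b}"
        using ab(1-3) p q by auto
      ultimately show False
        using \<open>{u..v} \<subseteq> closure I\<close> by blast
    qed
    moreover have "I \<subseteq> closure I"
      by (rule closure_subset)
    then have "0 \<in> closure I" "\<forall>x\<in>topspace X. \<forall>y\<in>topspace X. d x y \<in> closure I"
      by (auto simp: I_def)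
    ultimately show "d \<in> DC X"
      using d unfolding DC_def closed_totally_disconnected_sets_def Met_in_def
      by (intro UN_I[of "closure I"]) auto
  qed
qed

lemma gdelta_in_DC: "gdelta_in (Met_topology X) (DC X)"
proof -
  let ?P = "{(p, q) \<in> \<rat> \<times> \<rat>. p < (q :: real)}"
  have "countable (\<rat> \<times> \<rat> :: (real \<times> real) set)"
    by (intro countable_SIGMA countable_rat)
  then have "countable ?P"
    by (rule countable_subset[rotated]) auto
  moreover have "(0, 1) \<in> ?P"
    by auto
  then have "?P \<noteq> {}"
    by blast
  ultimately show ?thesis
    unfolding DC_eq_Inter_gap_metrics
    by (intro gdelta_in_Inter countable_image)
      (simp_all only: image_is_empty not_False_eq_True, auto intro: open_imp_gdelta_in openin_gap_metrics)
qed

section \<open>Locally constant approximations of the identity\<close>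

text \<open>Stone's argument: relative to a well-ordering, let \<open>m y\<close> be the least centre of an
  \<open>\<epsilon>\<close>-ball containing \<open>y\<close>. On the set \<open>S n\<close> of points lying at least \<open>2 * \<delta> n\<close> deep in
  that ball, \<open>m\<close> is constant at scale \<open>2 * \<delta> n\<close>, hence extends to a locally constant map on the
  \<open>\<delta> n\<close>-neighbourhood \<open>W n\<close>. Clopen sets \<open>V n\<close> between \<open>S n\<close> and \<open>W n\<close> allow to glue these maps.\<close>

lemma (in Metric_space) locally_constant_approximation:
  assumes dim: "strongly_zero_dimensional mtopology" and "0 < \<epsilon>"
  obtains f where "\<And>x. x \<in> M \<Longrightarrow> f x \<in> M" "\<And>x. x \<in> M \<Longrightarrow> d x (f x) < \<epsilon>"
    "\<And>x. x \<in> M \<Longrightarrow> \<exists>r>0. \<forall>y\<in>M. d x y < r \<longrightarrow> f y = f x"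
proof -
  obtain R :: "'a rel" where R: "well_order_on UNIV R"
    using well_order_on by blast
  have "\<exists>z. (z \<in> M \<and> d z y < \<epsilon>) \<and> (\<forall>w. w \<in> M \<and> d w y < \<epsilon> \<longrightarrow> (w, z) \<notin> R - Id)" if "y \<in> M" for y
  proof -
    have "y \<in> {z \<in> M. d z y < \<epsilon>}"
      using that \<open>0 < \<epsilon>\<close> by simp
    moreover have "wf (R - Id)"
      using R by (simp add: well_order_on_def)
    ultimately show ?thesis
      by (elim wfE_min[of _ y]) blast+
  qed
  then obtain m where m: "\<And>y. y \<in> M \<Longrightarrow> m y \<in> M" "\<And>y. y \<in> M \<Longrightarrow> d (m y) y < \<epsilon>"
    "\<And>y w. y \<in> M \<Longrightarrow> w \<in> M \<Longrightarrow> d w y < \<epsilon> \<Longrightarrow> (w, m y) \<notin> R - Id"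
    by metis
  have total: "(u, v) \<in> R - Id \<or> (v, u) \<in> R - Id" if "u \<noteq> v" for u v
    using R that by (auto simp: well_order_on_def linear_order_on_def total_on_def)
  define \<delta> :: "nat \<Rightarrow> real" where "\<delta> n = 1 / real (Suc n)" for n
  have \<delta>: "\<delta> n > 0" for n
    by (simp add: \<delta>_def)
  define S where "S n = {y \<in> M. d (m y) y \<le> \<epsilon> - 2 * \<delta> n}" for n
  \<comment> \<open>If \<open>m y\<close> strictly precedes \<open>m y'\<close>, minimality of
    \<open>m y'\<close> keeps \<open>y'\<close> outside the ball around \<open>m y\<close>, while
    \<open>y\<close> lies \<open>2 * \<delta> n\<close> deep inside it.\<close>
  have far: "2 * \<delta> n \<le> d y y'" if "y \<in> S n" "y' \<in> S n" "(m y, m y') \<in> R - Id" for n y y'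
  proof -
    have "\<not> d (m y) y' < \<epsilon>"
      using m that by (auto simp: S_def)
    moreover have "d (m y) y' \<le> d (m y) y + d y y'"
      using m that by (intro triangle) (auto simp: S_def)
    ultimately show ?thesis
      using that by (auto simp: S_def)
  qed
  have m_eq: "m y = m y'" if "y \<in> S n" "y' \<in> S n" "d y y' < 2 * \<delta> n" for n y y'
    using far[of y n y'] far[of y' n y] total[of "m y" "m y'"] that commute[of y y']
    by (metis linorder_not_less)
  define W where "W n = (\<Union>y\<in>S n. mball y (\<delta> n))" for n
  have "\<exists>V. openin mtopology V \<and> closedin mtopology V \<and> mtopology closure_of S n \<subseteq> V \<and> V \<subseteq> W n" for n
  proof -
    have "openin mtopology (W n)"
      by (auto simp: W_def)
    then have "closedin mtopology (M - W n)"
      by (metis closedin_diff closedin_mspace)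
    \<comment> \<open>Separation by a clopen set is available for closed sets only, so
      \<open>S n\<close> is replaced by its closure, which is still within \<open>\<delta> n\<close>
      of \<open>S n\<close>.\<close>
    moreover have "mtopology closure_of S n \<subseteq> W n"
    proof
      fix z assume "z \<in> mtopology closure_of S n"
      then obtain y where "y \<in> S n" "y \<in> mball z (\<delta> n)"
        using \<delta>[of n] unfolding metric_closure_of by blast
      then show "z \<in> W n"
        using commute by (auto simp: W_def)
    qed
    then have "mtopology closure_of S n \<inter> (M - W n) = {}"
      by blast
    ultimately obtain V where "openin mtopology V" "closedin mtopology V"
      "mtopology closure_of S n \<subseteq> V" "V \<inter> (M - W n) = {}"
      using dim closedin_closure_of unfolding strongly_zero_dimensional_def by metis
    moreover have "V \<subseteq> M"
      using openin_subset[OF \<open>openin mtopology V\<close>] by simp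
    ultimately show ?thesis
      by blast
  qed
  then obtain V where V: "\<And>n. openin mtopology (V n)" "\<And>n. closedin mtopology (V n)"
    "\<And>n. mtopology closure_of S n \<subseteq> V n" "\<And>n. V n \<subseteq> W n"
    by metis
  \<comment> \<open>Since \<open>d (m z) z < \<epsilon>\<close> is strict and
    \<open>\<delta> n\<close> tends to 0, every point is eventually deep enough to lie in
    \<open>S n\<close>.\<close>
  have cover: "\<exists>n. z \<in> V n" if z: "z \<in> M" for z
  proof -
    obtain n where "inverse (real (Suc n)) < (\<epsilon> - d (m z) z) / 2"
      using reals_Archimedean[of "(\<epsilon> - d (m z) z) / 2"] m(2)[OF z] by auto
    then have "z \<in> S n"
      using z by (simp add: S_def \<delta>_def inverse_eq_divide)
    moreover have "S n \<subseteq> mtopology closure_of S n"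
      by (rule closure_of_subset) (auto simp: S_def)
    ultimately show ?thesis
      using V(3) by blast
  qed
  \<comment> \<open>Taking the first index turns the clopen cover into a partition into clopen
    sets.\<close>
  define N where "N z = (LEAST n. z \<in> V n)" for z
  have N: "z \<in> V (N z)" if "z \<in> M" for z
    unfolding N_def using cover[OF that] by (rule LeastI_ex)
  \<comment> \<open>The choice \<open>c z\<close> of such a point may vary wildly with
    \<open>z\<close>; only \<open>m (c z)\<close> will be locally constant, by
    \<open>m_eq\<close>.\<close>
  have "\<exists>y. y \<in> S (N z) \<and> d y z < \<delta> (N z)" if "z \<in> M" for z
    using subsetD[OF V(4) N[OF that]] by (auto simp: W_def)
  then obtain c where c: "\<And>z. z \<in> M \<Longrightarrow> c z \<in> S (N z)" "\<And>z. z \<in> M \<Longrightarrow> d (c z) z < \<delta> (N z)"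
    by metis
  have cM: "c z \<in> M" if "z \<in> M" for z
    using c(1)[OF that] by (simp add: S_def)
  show thesis
  proof (rule that[of "\<lambda>z. m (c z)"])
    fix z assume z: "z \<in> M"
    show "m (c z) \<in> M"
      using m cM z by blast
    have "d z (m (c z)) \<le> d (m (c z)) (c z) + d (c z) z"
      using triangle[of "m (c z)" "c z" z] m(1) cM z by (simp add: commute)
    also have "\<dots> < \<epsilon>"
      using c[OF z] \<delta>[of "N z"] by (simp add: S_def)
    finally show "d z (m (c z)) < \<epsilon>" .
    \<comment> \<open>On this open neighbourhood of \<open>z\<close> the index \<open>N\<close> is
      constant and \<open>c z\<close> is within \<open>\<delta> (N z)\<close>. Hence
      \<open>c y\<close> and \<open>c z\<close> are less than \<open>2 * \<delta> (N z)\<close>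
      apart, which is the range of \<open>m_eq\<close>.\<close>
    let ?T = "(V (N z) - (\<Union>k<N z. V k)) \<inter> mball (c z) (\<delta> (N z))"
    have "closedin mtopology (\<Union>k<N z. V k)"
      using V(2) by (intro closedin_Union) auto
    then have "openin mtopology ?T"
      by (rule openin_Int[OF openin_diff[OF V(1)] openin_mball])
    moreover have "z \<notin> V k" if "k < N z" for k
      using that unfolding N_def by (rule not_less_Least)
    then have "z \<in> ?T"
      using N[OF z] c(2)[OF z] z cM by auto
    ultimately obtain r where r: "r > 0" "mball z r \<subseteq> ?T"
      unfolding openin_mtopology by blast
    have "m (c y) = m (c z)" if "y \<in> M" "d z y < r" for y
    proof -
      have y: "y \<in> ?T"
        using r(2) that z by auto
      then have "N y = N z"
        unfolding N_def[of y] by (intro Least_equality) (auto intro: leI)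
      have "d (c y) (c z) \<le> d (c y) y + d y (c z)"
        using cM z that by (intro triangle) auto
      also have "\<dots> < 2 * \<delta> (N z)"
        using c(2)[of y] y that \<open>N y = N z\<close> by (simp add: commute)
      finally show ?thesis
        using m_eq[of "c y" "N z" "c z"] c(1) z that \<open>N y = N z\<close> by metis
    qed
    then show "\<exists>r>0. \<forall>y\<in>M. d z y < r \<longrightarrow> m (c y) = m (c z)"
      using r(1) by blast
  qed
qed

section \<open>Approximation by metrics with a sparse set of values\<close>

text \<open>The assumption \<open>fine\<close> is continuity of the identity map from
  \<open>(M, e)\<close> to \<open>(M, d)\<close>.\<close>

lemma openin_mtopology_transfer:
  assumes d: "Metric_space M d" and e: "Metric_space M e"
    and fine: "\<And>x r. x \<in> M \<Longrightarrow> 0 < r \<Longrightarrow> \<exists>s>0. \<forall>y\<in>M. e x y < s \<longrightarrow> d x y < r"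
    and U: "openin (Metric_space.mtopology M d) U"
  shows "openin (Metric_space.mtopology M e) U"
  unfolding Metric_space.openin_mtopology[OF e]
proof (intro conjI allI impI)
  show UM: "U \<subseteq> M"
    using U unfolding Metric_space.openin_mtopology[OF d] by blast
  fix x assume "x \<in> U"
  then obtain r where r: "r > 0" "Metric_space.mball M d x r \<subseteq> U"
    using U unfolding Metric_space.openin_mtopology[OF d] by blast
  obtain s where "s > 0" "\<forall>y\<in>M. e x y < s \<longrightarrow> d x y < r"
    using fine \<open>x \<in> U\<close> UM r(1) by blast
  then show "\<exists>s>0. Metric_space.mball M e x s \<subseteq> U"
    using r(2) unfolding Metric_space.mball_def[OF d] Metric_space.mball_def[OF e] by blast
qed

text \<open>The multiples of \<open>\<epsilon>\<close> serve as distances between pieces of a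
  partition, the values \<open>\<epsilon> / 2 ^ n\<close> as distances inside a piece.\<close>

definition sparse_values :: "real \<Rightarrow> real set" where
  "sparse_values \<epsilon> = range (\<lambda>n. \<epsilon> * real n) \<union> insert 0 (range (\<lambda>n. \<epsilon> / 2 ^ n))"

text \<open>A countable set contains no nondegenerate interval. Closedness comes from a scaled copy
  of the naturals and a convergent sequence together with its limit.\<close>

lemma sparse_values_closed_totally_disconnected:
  assumes "0 < \<epsilon>"
  shows "sparse_values \<epsilon> \<in> closed_totally_disconnected_sets"
proof -
  have "closed (range (\<lambda>n. \<epsilon> * real n))"
    using closed_scaling[OF closed_Nats[where ?'a = real], of \<epsilon>]
    by (simp add: Nats_def image_image)
  moreover have "(\<lambda>n. \<epsilon> / 2 ^ n) \<longlonglongrightarrow> 0"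
    by real_asymp
  then have "closed (insert 0 (range (\<lambda>n. \<epsilon> / 2 ^ n)))"
    by (intro compact_imp_closed compact_sequence_with_limit)
  ultimately have "closed (sparse_values \<epsilon>)"
    unfolding sparse_values_def by (rule closed_Un)
  moreover have "countable (sparse_values \<epsilon>)"
    by (simp add: sparse_values_def)
  then have "\<not> {p..q} \<subseteq> sparse_values \<epsilon>" if "p < q" for p q
    using that countable_subset uncountable_closed_interval by blast
  ultimately show ?thesis
    using assms by (auto simp: closed_totally_disconnected_sets_def totally_disconnected_real_iff
        sparse_values_def)
qed

lemma ex_sparse_metric_near:
  assumes dim: "strongly_zero_dimensional X" and d: "d \<in> Met X" and "0 < \<epsilon>"
  shows "\<exists>e \<in> Met_in X (sparse_values \<epsilon>). \<forall>x\<in>topspace X. \<forall>y\<in>topspace X. \<bar>d x y - e x y\<bar> \<le> 3 * \<epsilon>"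
proof -
  define M where "M = topspace X"
  interpret Metric_space M d
    using d by (simp add: Met_in_def M_def)
  have X: "mtopology = X"
    using d by (simp add: Met_in_def M_def)
  have "\<exists>f. (\<forall>x\<in>M. f x \<in> M \<and> d x (f x) < \<epsilon> / 2 ^ n \<and>
      (\<exists>r>0. \<forall>y\<in>M. d x y < r \<longrightarrow> f y = f x))" for n :: nat
    using locally_constant_approximation[of "\<epsilon> / 2 ^ n"] dim \<open>0 < \<epsilon>\<close> unfolding X
    by (metis divide_pos_pos zero_less_numeral zero_less_power)
  then obtain F :: "nat \<Rightarrow> 'a \<Rightarrow> 'a" where F: "\<And>n x. x \<in> M \<Longrightarrow> F n x \<in> M"
    "\<And>n x. x \<in> M \<Longrightarrow> d x (F n x) < \<epsilon> / 2 ^ n"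
    "\<And>n x. x \<in> M \<Longrightarrow> \<exists>r>0. \<forall>y\<in>M. d x y < r \<longrightarrow> F n y = F n x"
    by metis
  \<comment> \<open>The fibres of \<open>F n\<close> are the pieces of the partition at level
    \<open>n\<close>.\<close>
  have near: "d x y < 2 * (\<epsilon> / 2 ^ n)" if "x \<in> M" "y \<in> M" "F n x = F n y" for x y n
    using triangle[of x "F n x" y] F(1,2)[of x n] F(2)[of y n] commute that by force
  have small: "\<exists>n. \<epsilon> / 2 ^ n < r" if "0 < r" for r :: real
  proof -
    have "(\<lambda>n. \<epsilon> / 2 ^ n) \<longlonglongrightarrow> 0"
      by real_asymp
    then have "\<forall>\<^sub>F n in sequentially. \<epsilon> / 2 ^ n < r"
      using that by (rule order_tendstoD)
    then show ?thesis
      by (auto simp: eventually_sequentially)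
  qed
  have mono: "\<epsilon> / 2 ^ n \<le> \<epsilon> / 2 ^ k" if "k \<le> n" for k n :: nat
    using that \<open>0 < \<epsilon>\<close> by (intro divide_left_mono power_increasing) auto
  have separate: "\<exists>n. F n x \<noteq> F n y" if "x \<in> M" "y \<in> M" "x \<noteq> y" for x y
  proof (rule ccontr)
    assume "\<not> (\<exists>n. F n x \<noteq> F n y)"
    moreover have "0 < d x y / 2"
      using that by simp
    then obtain n where "\<epsilon> / 2 ^ n < d x y / 2"
      using small by blast
    moreover have "F n x = F n y"
      using calculation(1) by blast
    ultimately show False
      using near[OF that(1,2), of n] by linarith
  qed
  \<comment> \<open>The partitions for different \<open>n\<close> need not refine each other;
    recording the first level that separates two points amounts to using their common
    refinements.\<close>
  define L where "L x y = (LEAST n. F n x \<noteq> F n y)" for x y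
  have L: "F (L x y) x \<noteq> F (L x y) y" if "x \<in> M" "y \<in> M" "x \<noteq> y" for x y
    unfolding L_def using separate[OF that] by (rule LeastI_ex)
  have L_le: "L x y \<le> n" if "F n x \<noteq> F n y" for x y n
    unfolding L_def using that by (rule Least_le)
  \<comment> \<open>Rounding up is subadditive and so preserves the triangle inequality; it also
    puts distinct fibres of \<open>F 0\<close> at distance at least \<open>\<epsilon>\<close>, the
    largest distance inside a fibre.\<close>
  define h where "h x y = \<epsilon> * of_int \<lceil>d (F 0 x) (F 0 y) / \<epsilon>\<rceil>" for x y
  define e where "e x y = (if x \<notin> M \<or> y \<notin> M \<or> x = y then 0
      else if F 0 x \<noteq> F 0 y then h x y else \<epsilon> / 2 ^ L x y)" for x y
  have h_bounds: "d (F 0 x) (F 0 y) \<le> h x y" "h x y < d (F 0 x) (F 0 y) + \<epsilon>" for x y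
  proof -
    have "d (F 0 x) (F 0 y) / \<epsilon> \<le> of_int \<lceil>d (F 0 x) (F 0 y) / \<epsilon>\<rceil>"
      "of_int \<lceil>d (F 0 x) (F 0 y) / \<epsilon>\<rceil> < d (F 0 x) (F 0 y) / \<epsilon> + 1"
      by linarith+
    then show "d (F 0 x) (F 0 y) \<le> h x y" "h x y < d (F 0 x) (F 0 y) + \<epsilon>"
      using \<open>0 < \<epsilon>\<close> by (simp_all add: h_def field_simps del: le_of_int_ceiling)
  qed
  have h_ge: "\<epsilon> \<le> h x y" if "x \<in> M" "y \<in> M" "F 0 x \<noteq> F 0 y" for x y
  proof -
    have "0 < d (F 0 x) (F 0 y)"
      using F(1) that by simp
    then have "1 \<le> \<lceil>d (F 0 x) (F 0 y) / \<epsilon>\<rceil>"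
      using \<open>0 < \<epsilon>\<close> by simp
    then show ?thesis
      using \<open>0 < \<epsilon>\<close> unfolding h_def by simp
  qed
  have h_triangle: "h x z \<le> h x y + h y z" if "x \<in> M" "y \<in> M" "z \<in> M" for x y z
  proof -
    have "d (F 0 x) (F 0 z) / \<epsilon> \<le> d (F 0 x) (F 0 y) / \<epsilon> + d (F 0 y) (F 0 z) / \<epsilon>"
      using triangle F(1) that \<open>0 < \<epsilon>\<close> by (simp add: divide_right_mono flip: add_divide_distrib)
    then have "\<lceil>d (F 0 x) (F 0 z) / \<epsilon>\<rceil> \<le> \<lceil>d (F 0 x) (F 0 y) / \<epsilon>\<rceil> + \<lceil>d (F 0 y) (F 0 z) / \<epsilon>\<rceil>"
      by linarith
    then have "(of_int \<lceil>d (F 0 x) (F 0 z) / \<epsilon>\<rceil> :: real) \<le>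
        of_int \<lceil>d (F 0 x) (F 0 y) / \<epsilon>\<rceil> + of_int \<lceil>d (F 0 y) (F 0 z) / \<epsilon>\<rceil>"
      by linarith
    then show ?thesis
      using \<open>0 < \<epsilon>\<close> unfolding h_def by (simp flip: distrib_left)
  qed
  have h_cong: "h x z = h y z" "h z x = h z y" if "F 0 x = F 0 y" for x y z
    using that by (simp_all add: h_def)
  have e_pos: "0 < e x y" if "x \<in> M" "y \<in> M" "x \<noteq> y" for x y
    using h_ge[of x y] that \<open>0 < \<epsilon>\<close> by (force simp: e_def)
  have e_nonneg: "0 \<le> e x y" for x y
    using e_pos[of x y] by (cases "x \<in> M \<and> y \<in> M \<and> x \<noteq> y") (auto simp: e_def)
  have e_le: "e x y \<le> \<epsilon>" if "F 0 x = F 0 y" for x y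
    using that mono[of 0 "L x y"] \<open>0 < \<epsilon>\<close> by (auto simp: e_def)
  have e_commute: "e x y = e y x" for x y
    by (auto simp: e_def h_def L_def commute eq_commute)
  have F_eq: "F n x = F n y" if "x \<in> M" "y \<in> M" "e x y < \<epsilon> / 2 ^ n" for x y n
  proof (cases "x = y \<or> F 0 x \<noteq> F 0 y")
    case True
    then show ?thesis
      using that h_ge[of x y] mono[of 0 n] by (auto simp: e_def split: if_splits)
  next
    case False
    then have "n < L x y"
      using that mono[of "L x y" n] by (force simp: e_def)
    then show ?thesis
      using L_le[of n x y] by linarith
  qed
  interpret e: Metric_space M e
  proof
    show "0 \<le> e x y" "e x y = e y x" for x y
      by (rule e_nonneg, rule e_commute)
    show "e x y = 0 \<longleftrightarrow> x = y" if "x \<in> M" "y \<in> M" for x y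
      using e_pos[OF that] by (cases "x = y") (auto simp: e_def)
    show "e x z \<le> e x y + e y z" if "x \<in> M" "y \<in> M" "z \<in> M" for x y z
    proof (cases "x = y \<or> y = z \<or> x = z")
      case True
      then show ?thesis
        using e_nonneg[of x y] e_nonneg[of y z] by (auto simp: e_def)
    next
      case False
      have across: "e u v = h u v" if "u \<in> M" "v \<in> M" "F 0 u \<noteq> F 0 v" for u v
        using that by (auto simp: e_def)
      \<comment> \<open>Inside one fibre the level separating \<open>x\<close> from \<open>z\<close>
        separates \<open>y\<close> from one of them, giving the ultrametric inequality. If only
        \<open>y\<close> is outside, then \<open>e x z \<le> \<epsilon> \<le> e x y\<close>. If
        \<open>y\<close> shares a fibre with exactly one of \<open>x\<close> and \<open>z\<close>,
        one summand equals \<open>e x z\<close>. Three different fibres are handled by subadditivity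
        of \<open>h\<close>.\<close>
      consider "F 0 x = F 0 z" "F 0 x = F 0 y" | "F 0 x = F 0 z" "F 0 x \<noteq> F 0 y"
        | "F 0 x \<noteq> F 0 z" "F 0 x = F 0 y" | "F 0 x \<noteq> F 0 z" "F 0 y = F 0 z"
        | "F 0 x \<noteq> F 0 z" "F 0 x \<noteq> F 0 y" "F 0 y \<noteq> F 0 z"
        by metis
      then show ?thesis
      proof cases
        case 1
        have "F (L x z) x \<noteq> F (L x z) y \<or> F (L x z) y \<noteq> F (L x z) z"
          using L[of x z] that False by auto
        then have "L x y \<le> L x z \<or> L y z \<le> L x z"
          using L_le by blast
        moreover have "e x z = \<epsilon> / 2 ^ L x z" "e x y = \<epsilon> / 2 ^ L x y" "e y z = \<epsilon> / 2 ^ L y z"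
          using 1 that False by (auto simp: e_def)
        ultimately have "e x z \<le> e x y \<or> e x z \<le> e y z"
          using mono by auto
        then show ?thesis
          using e_nonneg[of x y] e_nonneg[of y z] by linarith
      next
        case 2
        then show ?thesis
          using e_le[of x z] across[of x y] h_ge[of x y] e_nonneg[of y z] that by auto
      next
        case 3
        then show ?thesis
          using across[of x z] across[of y z] h_cong(1)[of x y z] e_nonneg[of x y] that by auto
      next
        case 4
        then show ?thesis
          using across[of x z] across[of x y] h_cong(2)[of y z x] e_nonneg[of y z] that by auto
      next
        case 5
        then show ?thesis
          using across h_triangle that by simp
      qed
    qed
  qed
  have d_fine: "\<exists>s>0. \<forall>y\<in>M. e x y < s \<longrightarrow> d x y < r" if x: "x \<in> M" and "0 < r" for x r
  proof -
    obtain n where n: "\<epsilon> / 2 ^ n < r / 2"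
      using small[of "r / 2"] \<open>0 < r\<close> by auto
    have "d x y < r" if "y \<in> M" "e x y < \<epsilon> / 2 ^ n" for y
      using near[OF x that(1) F_eq[OF x that]] n by linarith
    then show ?thesis
      using \<open>0 < \<epsilon>\<close> by (intro exI[of _ "\<epsilon> / 2 ^ n"]) auto
  qed
  have e_fine: "\<exists>s>0. \<forall>y\<in>M. d x y < s \<longrightarrow> e x y < r" if x: "x \<in> M" and "0 < r" for x r
  proof -
    obtain n where n: "\<epsilon> / 2 ^ n < r"
      using small \<open>0 < r\<close> by blast
    obtain \<rho> where \<rho>: "\<And>k. \<rho> k > 0" "\<And>k y. y \<in> M \<Longrightarrow> d x y < \<rho> k \<Longrightarrow> F k y = F k x"
      using F(3)[OF x] by metis
    \<comment> \<open>Only finitely many levels have to agree: if none up to \<open>n\<close>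
      separates \<open>x\<close> from \<open>y\<close>, then
      \<open>e x y \<le> \<epsilon> / 2 ^ n\<close>.\<close>
    define s where "s = Min (\<rho> ` {..n})"
    have "e x y < r" if y: "y \<in> M" "d x y < s" for y
    proof (cases "x = y")
      case True
      then show ?thesis
        using \<open>0 < r\<close> by (simp add: e_def)
    next
      case False
      have same: "F k x = F k y" if "k \<le> n" for k
      proof -
        have "s \<le> \<rho> k"
          unfolding s_def using that by (intro Min_le) auto
        then show ?thesis
          using \<rho>(2)[of y k] y by simp
      qed
      then have "n \<le> L x y"
        using L[OF x y(1) False] by (metis nat_le_linear)
      then show ?thesis
        using same[of 0] False x y(1) mono[of n "L x y"] n by (simp add: e_def)
    qed
    moreover have "0 < s"
      unfolding s_def using \<rho>(1) by (subst Min_gr_iff) auto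
    ultimately show ?thesis
      by blast
  qed
  have "e.mtopology = mtopology"
    unfolding topology_eq
  proof (intro allI iffI)
    fix U
    show "openin e.mtopology U \<Longrightarrow> openin mtopology U"
      by (rule openin_mtopology_transfer[OF e.Metric_space_axioms Metric_space_axioms e_fine])
    show "openin mtopology U \<Longrightarrow> openin e.mtopology U"
      by (rule openin_mtopology_transfer[OF Metric_space_axioms e.Metric_space_axioms d_fine])
  qed
  moreover have "e x y \<in> sparse_values \<epsilon>" for x y
  proof -
    have "0 \<le> \<lceil>d (F 0 x) (F 0 y) / \<epsilon>\<rceil>"
      using \<open>0 < \<epsilon>\<close> nonneg[of "F 0 x" "F 0 y"] by (metis ceiling_mono ceiling_zero divide_nonneg_pos)
    then have "h x y = \<epsilon> * real (nat \<lceil>d (F 0 x) (F 0 y) / \<epsilon>\<rceil>)"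
      by (simp add: h_def)
    then show ?thesis
      by (auto simp: e_def sparse_values_def)
  qed
  moreover have "e x y = 0" if "x \<notin> M \<or> y \<notin> M" for x y
    using that by (auto simp: e_def)
  ultimately have "e \<in> Met_in X (sparse_values \<epsilon>)"
    using X e.Metric_space_axioms unfolding Met_in_def M_def[symmetric] by auto
  \<comment> \<open>Across fibres, passing to the two representatives costs less than
    \<open>\<epsilon>\<close> each, and rounding up less than a third \<open>\<epsilon>\<close>.
    Within a fibre, \<open>d x y < 2 * \<epsilon>\<close> and
    \<open>e x y \<le> \<epsilon>\<close>.\<close>
  moreover have "\<bar>d x y - e x y\<bar> \<le> 3 * \<epsilon>" if "x \<in> M" "y \<in> M" for x y
  proof (cases "F 0 x = F 0 y")
    case True
    then have "d x y < 2 * \<epsilon>"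
      using near[of x y 0] that by simp
    then show ?thesis
      using e_le[OF True] e_nonneg[of x y] nonneg[of x y] by linarith
  next
    case False
    then have "e x y = h x y"
      using that by (auto simp: e_def)
    moreover have "d x (F 0 x) < \<epsilon>" "d y (F 0 y) < \<epsilon>"
      using F(2)[of _ 0] that by auto
    moreover have "d x y \<le> d x (F 0 x) + d (F 0 x) (F 0 y) + d y (F 0 y)"
      using triangle[of x "F 0 x" y] triangle[of "F 0 x" "F 0 y" y] F(1) that
      by (simp add: commute)
    moreover have "d (F 0 x) (F 0 y) \<le> d x (F 0 x) + d x y + d y (F 0 y)"
      using triangle[of "F 0 x" x "F 0 y"] triangle[of x y "F 0 y"] F(1) that
      by (simp add: commute)
    ultimately show ?thesis
      using h_bounds[of x y] by linarith
  qed
  ultimately show ?thesis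
    unfolding M_def by blast
qed

theorem theorem1p1:
  fixes X :: "'a topology"
  assumes "metrizable_space X" and "strongly_zero_dimensional X"
  shows "Met_topology X closure_of DC X = topspace (Met_topology X) \<and>
         gdelta_in (Met_topology X) (DC X)"
proof
  have "d \<in> Met_topology X closure_of DC X" if d: "d \<in> Met X" for d
    unfolding in_closure_of topspace_Met_topology
  proof (intro conjI allI impI d)
    fix U assume U: "d \<in> U \<and> openin (Met_topology X) U"
    then obtain r where r: "r > 0" "\<And>e. e \<in> Met X \<Longrightarrow>
        (\<forall>x\<in>topspace X. \<forall>y\<in>topspace X. \<bar>d x y - e x y\<bar> \<le> r) \<Longrightarrow> e \<in> U"
      using openin_Met_topology_imp by metis
    obtain e where e: "e \<in> Met_in X (sparse_values (r / 3))"
      "\<forall>x\<in>topspace X. \<forall>y\<in>topspace X. \<bar>d x y - e x y\<bar> \<le> r"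
      using ex_sparse_metric_near[OF assms(2) d, of "r / 3"] r(1) by auto
    have S: "sparse_values (r / 3) \<in> closed_totally_disconnected_sets"
      using r(1) by (intro sparse_values_closed_totally_disconnected) simp
    then have "e \<in> DC X"
      using e(1) by (auto simp: DC_def)
    moreover have "e \<in> Met X"
      using e(1) S by (auto simp: Met_in_def closed_totally_disconnected_sets_def)
    ultimately show "\<exists>e. e \<in> DC X \<and> e \<in> U"
      using r(2) e(2) by blast
  qed
  then show "Met_topology X closure_of DC X = topspace (Met_topology X)"
    using closure_of_subset_topspace[of "Met_topology X" "DC X"]
    unfolding topspace_Met_topology by blast
  show "gdelta_in (Met_topology X) (DC X)"
    by (rule gdelta_in_DC)
qed

end
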